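(* Consider the following four classes of transformation semigroups: (A) the class of all distal transformation semigroups; (B) the class of all transformation semigroups co-decomposable to distal transformation semigroups; (C) the class of all transformation semigroups pseudo-co-decomposable to distal transformation semigroups; (D) the class of all transformation semigroups. Then $A\subset B\subset C\subset D$, where every inclusion is strict.
   Context: A transformation semigroup (group) $(X,S)$ consists of a compact Hausdorff space $X$, a discrete topological semigroup (group) $S$ with identity $e$, and a continuous map $X\times S\to X$, $(x,s)\mapsto xs$, such that $xe=x$ and $x(st)=(xs)t$ for all $x\in X$, $s,t\in S$. For $A\subseteq X$ and $S'\subseteq S$, $AS'=\{as:a\in A,s\in S'\}$, and $xS'=\{x\}S'$. Distality: $P(X,S)$ is the set of all $(x,y)\in X\times X$ for which there exist a net $\{t_\alpha\}$ in $S$ and $z\in X$ with $\lim xt_\alpha=z=\lim yt_\alpha$. $(X,S)$ is distal if $P(X,S)=\{(x,x):x\in X\}$. Multi-transformation semigroup: for a nonempty collection $\{(X,S_\alpha):\alpha\in\Gamma\}$ of transformation semigroups, $(X,(S_\alpha:\alpha\in\Gamma))$ is a multi-transformation semigroup if for all distinct $\alpha_1,\dots,\alpha_n\in\Gamma$, all $x\in X$, all $s_i\in S_{\alpha_i}$ and every permutation $k\mapsto m_k$ of $\{1,\dots,n\}$, $(\cdots((xs_1)s_2)\cdots)s_n=(\cdots((xs_{m_1})s_{m_2})\cdots)s_{m_n}$. Pseudo-multi-transformation semigroup: $(X,(S_\alpha:\alpha\in\Gamma))$ is one if for all (not necessarily distinct) $\alpha_1,\dots,\alpha_n\in\Gamma$,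 all $x\in X$ and every permutation $k\mapsto m_k$ of $\{1,\dots,n\}$, $(\cdots((xS_{\alpha_1})S_{\alpha_2})\cdots)S_{\alpha_n}=(\cdots((xS_{\alpha_{m_1}})S_{\alpha_{m_2}})\cdots)S_{\alpha_{m_n}}$ (equality of subsets of $X$). A co-decomposition (respectively pseudo-co-decomposition) of $(X,S)$ is a multi-transformation (respectively pseudo-multi-transformation) semigroup $(X,(S_\alpha:\alpha\in\Gamma))$ in which the $S_\alpha$ are pairwise distinct sub-semigroups of $S$ acting on $X$ by restriction of the action of $S$ (each $(X,S_\alpha)$ being itself a transformation semigroup, so $S_\alpha$ has an identity acting as the identity map), such that the semigroup generated by $\bigcup_{\alpha\in\Gamma}S_\alpha$ is $S$. For a dynamical property $\mathsf P$, $(X,S)$ is co-decomposable (respectively pseudo-co-decomposable) to $\mathsf P$ transformation semigroups if it has a co-decomposition (respectively pseudo-co-decomposition) $(X,(S_\alpha:\alpha\in\Gamma))$ such that every $(X,S_\alpha)$ has property $\mathsf P$. *)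

theory Defs
  imports "HOL-Analysis.Analysis" "HOL-Algebra.Group" "HOL-Combinatorics.Permutations"
begin

text \<open>
  The phase space is an abstract topology \<open>X\<close> (with underlying set \<open>topspace X\<close>), the acting
  semigroup with identity is a monoid \<open>S\<close> with explicit carrier, and \<open>act x s\<close> is the right action
  \<open>x s\<close>. The values of \<open>act\<close> outside \<open>topspace X \<times> carrier S\<close> are irrelevant.
\<close>

definition transformation_semigroup ::
    "'x topology \<Rightarrow> 's monoid \<Rightarrow> ('x \<Rightarrow> 's \<Rightarrow> 'x) \<Rightarrow> bool" where
  "transformation_semigroup X S act \<longleftrightarrow>
     compact_space X \<and> Hausdorff_space X \<and> monoid S \<and>
     continuous_map (prod_topology X (discrete_topology (carrier S))) X (\<lambda>(x, s). act x s) \<and>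
     (\<forall>x\<in>topspace X. act x \<one>\<^bsub>S\<^esub> = x) \<and>
     (\<forall>x\<in>topspace X. \<forall>s\<in>carrier S. \<forall>t\<in>carrier S. act x (s \<otimes>\<^bsub>S\<^esub> t) = act (act x s) t)"

text \<open>
  Nets in \<open>S\<close> are rendered as proper filters on \<open>carrier S\<close>: a net gives the filter generated by
  its tails. The lemmas \<open>proximal_relation_if_net\<close> and \<open>net_if_proximal_relation\<close> below state that
  this is the relation defined by nets over directed sets.
\<close>

definition proximal_relation ::
    "'x topology \<Rightarrow> 's monoid \<Rightarrow> ('x \<Rightarrow> 's \<Rightarrow> 'x) \<Rightarrow> ('x \<times> 'x) set" where
  "proximal_relation X S act =
     {(x, y) \<in> topspace X \<times> topspace X.
        \<exists>F z. F \<noteq> bot \<and> F \<le> principal (carrier S) \<and>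
              limitin X (act x) z F \<and> limitin X (act y) z F}"

definition distal :: "'x topology \<Rightarrow> 's monoid \<Rightarrow> ('x \<Rightarrow> 's \<Rightarrow> 'x) \<Rightarrow> bool" where
  "distal X S act \<longleftrightarrow>
     transformation_semigroup X S act \<and> proximal_relation X S act = {(x, x) | x. x \<in> topspace X}"

definition directed_set :: "'i set \<Rightarrow> ('i \<Rightarrow> 'i \<Rightarrow> bool) \<Rightarrow> bool" where
  "directed_set D leq \<longleftrightarrow>
     D \<noteq> {} \<and> (\<forall>i\<in>D. leq i i) \<and>
     (\<forall>i\<in>D. \<forall>j\<in>D. \<forall>k\<in>D. leq i j \<longrightarrow> leq j k \<longrightarrow> leq i k) \<and>
     (\<forall>i\<in>D. \<forall>j\<in>D. \<exists>k\<in>D. leq i k \<and> leq j k)"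

definition net_limit ::
    "'x topology \<Rightarrow> 'i set \<Rightarrow> ('i \<Rightarrow> 'i \<Rightarrow> bool) \<Rightarrow> ('i \<Rightarrow> 'x) \<Rightarrow> 'x \<Rightarrow> bool" where
  "net_limit X D leq f z \<longleftrightarrow>
     z \<in> topspace X \<and>
     (\<forall>U. openin X U \<and> z \<in> U \<longrightarrow> (\<exists>i\<in>D. \<forall>j\<in>D. leq i j \<longrightarrow> f j \<in> U))"

lemma proximal_relation_if_net:
  assumes "directed_set D leq" "\<And>i. i \<in> D \<Longrightarrow> t i \<in> carrier S"
    and "x \<in> topspace X" "y \<in> topspace X"
    and "net_limit X D leq (\<lambda>i. act x (t i)) z" "net_limit X D leq (\<lambda>i. act y (t i)) z"
  shows "(x, y) \<in> proximal_relation X S act"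
proof -
  define B where "B i = principal (t ` {j \<in> D. leq i j})" for i
  define F where "F = (INF i\<in>D. B i)"
  have ev: "eventually P F \<longleftrightarrow> (\<exists>i\<in>D. \<forall>j\<in>D. leq i j \<longrightarrow> P (t j))" for P
  proof -
    have "eventually P F \<longleftrightarrow> (\<exists>i\<in>D. eventually P (B i))"
      unfolding F_def
    proof (rule eventually_INF_base)
      show "D \<noteq> {}" using assms(1) by (simp add: directed_set_def)
      fix a b assume ab: "a \<in> D" "b \<in> D"
      then obtain k where k: "k \<in> D" "leq a k" "leq b k"
        using assms(1) unfolding directed_set_def by blast
      have "{j \<in> D. leq k j} \<subseteq> {j \<in> D. leq a j} \<inter> {j \<in> D. leq b j}"
        using assms(1) ab k unfolding directed_set_def by blast
      then show "\<exists>k\<in>D. B k \<le> inf (B a) (B b)"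
        using k(1) unfolding B_def by (intro bexI[of _ k]) auto
    qed
    then show ?thesis by (auto simp: B_def eventually_principal)
  qed
  have "F \<noteq> bot"
    using assms(1) unfolding trivial_limit_def ev directed_set_def by blast
  moreover have "F \<le> principal (carrier S)"
    using assms(1,2) unfolding le_principal ev directed_set_def by blast
  moreover have "limitin X (act x) z F" "limitin X (act y) z F"
    using assms(5,6) by (auto simp: limitin_def net_limit_def ev)
  ultimately show ?thesis
    using assms(3,4) unfolding proximal_relation_def by blast
qed

lemma net_if_proximal_relation:
  fixes S :: "'s monoid"
  assumes "(x, y) \<in> proximal_relation X S act"
  obtains D leq z and t :: "'s set \<times> 's \<Rightarrow> 's"
  where "directed_set D leq" "\<And>i. i \<in> D \<Longrightarrow> t i \<in> carrier S"
    "net_limit X D leq (\<lambda>i. act x (t i)) z" "net_limit X D leq (\<lambda>i. act y (t i)) z"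
proof -
  obtain F z where F: "F \<noteq> bot" "eventually (\<lambda>s. s \<in> carrier S) F"
    "limitin X (act x) z F" "limitin X (act y) z F"
    using assms unfolding proximal_relation_def by (auto simp: le_principal)
  define D where "D = {(A, s). A \<subseteq> carrier S \<and> eventually (\<lambda>r. r \<in> A) F \<and> s \<in> A}"
  define leq where "leq i j \<longleftrightarrow> fst j \<subseteq> fst i" for i j :: "'s set \<times> 's"
  have ex: "\<exists>s. (A, s) \<in> D" if "A \<subseteq> carrier S" "eventually (\<lambda>r. r \<in> A) F" for A
    using that F(1) eventually_happens[of "\<lambda>r. r \<in> A" F] by (auto simp: D_def)
  have "directed_set D leq"
    unfolding directed_set_def
  proof (intro conjI)
    show "D \<noteq> {}" using ex[of "carrier S"] F(2) by auto
    show "\<forall>i\<in>D. \<forall>j\<in>D. \<exists>k\<in>D. leq i k \<and> leq j k"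
    proof (intro ballI)
      fix i j assume ij: "i \<in> D" "j \<in> D"
      have "eventually (\<lambda>r. r \<in> fst i \<inter> fst j) F"
        using ij by (auto simp: D_def eventually_conj_iff)
      moreover have "fst i \<inter> fst j \<subseteq> carrier S" using ij by (auto simp: D_def)
      ultimately obtain s where "(fst i \<inter> fst j, s) \<in> D" using ex by blast
      then show "\<exists>k\<in>D. leq i k \<and> leq j k"
        by (intro bexI[of _ "(fst i \<inter> fst j, s)"]) (auto simp: leq_def)
    qed
  qed (auto simp: leq_def)
  moreover have "snd i \<in> carrier S" if "i \<in> D" for i
    using that by (auto simp: D_def)
  moreover have "net_limit X D leq (\<lambda>i. act w (snd i)) z" if w: "limitin X (act w) z F" for w
    unfolding net_limit_def
  proof (intro conjI allI impI)
    show "z \<in> topspace X" using w by (simp add: limitin_def)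
    fix U assume "openin X U \<and> z \<in> U"
    then have "eventually (\<lambda>s. act w s \<in> U) F" using w by (simp add: limitin_def)
    then have "eventually (\<lambda>r. r \<in> {s \<in> carrier S. act w s \<in> U}) F"
      using F(2) by (auto simp: eventually_conj_iff)
    then obtain s where "({s \<in> carrier S. act w s \<in> U}, s) \<in> D"
      using ex[of "{s \<in> carrier S. act w s \<in> U}"] by blast
    then show "\<exists>i\<in>D. \<forall>j\<in>D. leq i j \<longrightarrow> act w (snd j) \<in> U"
      by (intro bexI[of _ "({s \<in> carrier S. act w s \<in> U}, s)"])
         (auto simp: leq_def D_def)
  qed
  ultimately show thesis using that F(3,4) by blast
qed

text \<open>
  In the following two definitions the permutation \<open>k \<mapsto> m\<^sub>k\<close> acts on the positions
  \<open>0, \<dots>, n - 1\<close> of a list of indices.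
\<close>

definition multi_transformation_semigroup ::
    "'x topology \<Rightarrow> 'i set \<Rightarrow> ('i \<Rightarrow> 's monoid) \<Rightarrow> ('i \<Rightarrow> 'x \<Rightarrow> 's \<Rightarrow> 'x) \<Rightarrow> bool" where
  "multi_transformation_semigroup X \<Gamma> S act \<longleftrightarrow>
     \<Gamma> \<noteq> {} \<and> (\<forall>\<alpha>\<in>\<Gamma>. transformation_semigroup X (S \<alpha>) (act \<alpha>)) \<and>
     (\<forall>ps :: ('i \<times> 's) list. \<forall>x\<in>topspace X. \<forall>m.
        distinct (map fst ps) \<longrightarrow> (\<forall>(\<alpha>, s)\<in>set ps. \<alpha> \<in> \<Gamma> \<and> s \<in> carrier (S \<alpha>)) \<longrightarrow>
        m permutes {..<length ps} \<longrightarrow>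
        foldl (\<lambda>u (\<alpha>, s). act \<alpha> u s) x ps = foldl (\<lambda>u (\<alpha>, s). act \<alpha> u s) x (permute_list m ps))"

definition set_act :: "('x \<Rightarrow> 's \<Rightarrow> 'x) \<Rightarrow> 'x set \<Rightarrow> 's set \<Rightarrow> 'x set" where
  "set_act act A T = {act a s | a s. a \<in> A \<and> s \<in> T}"

definition pseudo_multi_transformation_semigroup ::
    "'x topology \<Rightarrow> 'i set \<Rightarrow> ('i \<Rightarrow> 's monoid) \<Rightarrow> ('i \<Rightarrow> 'x \<Rightarrow> 's \<Rightarrow> 'x) \<Rightarrow> bool" where
  "pseudo_multi_transformation_semigroup X \<Gamma> S act \<longleftrightarrow>
     \<Gamma> \<noteq> {} \<and> (\<forall>\<alpha>\<in>\<Gamma>. transformation_semigroup X (S \<alpha>) (act \<alpha>)) \<and>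
     (\<forall>\<alpha>s :: 'i list. \<forall>x\<in>topspace X. \<forall>m.
        set \<alpha>s \<subseteq> \<Gamma> \<longrightarrow> m permutes {..<length \<alpha>s} \<longrightarrow>
        foldl (\<lambda>A \<alpha>. set_act (act \<alpha>) A (carrier (S \<alpha>))) {x} \<alpha>s =
        foldl (\<lambda>A \<alpha>. set_act (act \<alpha>) A (carrier (S \<alpha>))) {x} (permute_list m \<alpha>s))"

inductive_set semigroup_generated :: "('s, 'm) monoid_scheme \<Rightarrow> 's set \<Rightarrow> 's set"
  for S :: "('s, 'm) monoid_scheme" and A :: "'s set" where
  base: "a \<in> A \<Longrightarrow> a \<in> semigroup_generated S A"
| mult: "a \<in> semigroup_generated S A \<Longrightarrow> b \<in> semigroup_generated S A \<Longrightarrow>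
         a \<otimes>\<^bsub>S\<^esub> b \<in> semigroup_generated S A"

text \<open>
  The identity of a sub-semigroup \<open>M \<alpha>\<close> need not be the identity of \<open>S\<close>. That \<open>M \<alpha>\<close> is closed
  under multiplication and that its identity acts as the identity map is part of
  \<open>transformation_semigroup X (M \<alpha>) act\<close>, hence of the (pseudo-)multi-transformation semigroup.
\<close>

definition generating_subsemigroups :: "'s monoid \<Rightarrow> 'i set \<Rightarrow> ('i \<Rightarrow> 's monoid) \<Rightarrow> bool" where
  "generating_subsemigroups S \<Gamma> M \<longleftrightarrow>
     (\<forall>\<alpha>\<in>\<Gamma>. carrier (M \<alpha>) \<subseteq> carrier S \<and>
        (\<forall>s\<in>carrier (M \<alpha>). \<forall>t\<in>carrier (M \<alpha>). s \<otimes>\<^bsub>M \<alpha>\<^esub> t = s \<otimes>\<^bsub>S\<^esub> t)) \<and>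
     inj_on (\<lambda>\<alpha>. carrier (M \<alpha>)) \<Gamma> \<and>
     semigroup_generated S (\<Union>\<alpha>\<in>\<Gamma>. carrier (M \<alpha>)) = carrier S"

definition co_decomposition ::
    "'x topology \<Rightarrow> 's monoid \<Rightarrow> ('x \<Rightarrow> 's \<Rightarrow> 'x) \<Rightarrow> 'i set \<Rightarrow> ('i \<Rightarrow> 's monoid) \<Rightarrow> bool" where
  "co_decomposition X S act \<Gamma> M \<longleftrightarrow>
     multi_transformation_semigroup X \<Gamma> M (\<lambda>_. act) \<and> generating_subsemigroups S \<Gamma> M"

definition pseudo_co_decomposition ::
    "'x topology \<Rightarrow> 's monoid \<Rightarrow> ('x \<Rightarrow> 's \<Rightarrow> 'x) \<Rightarrow> 'i set \<Rightarrow> ('i \<Rightarrow> 's monoid) \<Rightarrow> bool" where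
  "pseudo_co_decomposition X S act \<Gamma> M \<longleftrightarrow>
     pseudo_multi_transformation_semigroup X \<Gamma> M (\<lambda>_. act) \<and> generating_subsemigroups S \<Gamma> M"

text \<open>
  Since the members of a (pseudo-)co-decomposition are pairwise distinct subsets of \<open>S\<close>, every
  index set can be replaced by a set of subsets of \<open>S\<close>. So taking the indices from \<open>'s set\<close>
  is no restriction.
\<close>

definition co_decomposable_to ::
    "('x topology \<Rightarrow> 's monoid \<Rightarrow> ('x \<Rightarrow> 's \<Rightarrow> 'x) \<Rightarrow> bool) \<Rightarrow>
     'x topology \<Rightarrow> 's monoid \<Rightarrow> ('x \<Rightarrow> 's \<Rightarrow> 'x) \<Rightarrow> bool" where
  "co_decomposable_to P X S act \<longleftrightarrow>
     transformation_semigroup X S act \<and>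
     (\<exists>(\<Gamma> :: 's set set) M. co_decomposition X S act \<Gamma> M \<and> (\<forall>\<alpha>\<in>\<Gamma>. P X (M \<alpha>) act))"

definition pseudo_co_decomposable_to ::
    "('x topology \<Rightarrow> 's monoid \<Rightarrow> ('x \<Rightarrow> 's \<Rightarrow> 'x) \<Rightarrow> bool) \<Rightarrow>
     'x topology \<Rightarrow> 's monoid \<Rightarrow> ('x \<Rightarrow> 's \<Rightarrow> 'x) \<Rightarrow> bool" where
  "pseudo_co_decomposable_to P X S act \<longleftrightarrow>
     transformation_semigroup X S act \<and>
     (\<exists>(\<Gamma> :: 's set set) M. pseudo_co_decomposition X S act \<Gamma> M \<and> (\<forall>\<alpha>\<in>\<Gamma>. P X (M \<alpha>) act))"

text \<open>
  The four classes, relative to types \<open>'x\<close> and \<open>'s\<close> in which the phase spaces and the semigroups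
  live. If \<open>'x\<close> or \<open>'s\<close> is finite, the first three classes coincide (for a finite phase space or
  a finite semigroup, distality means that every element acts injectively), so that strictness of
  the first two inclusions can only be witnessed over infinite types.
\<close>

type_synonym ('x, 's) action_triple = "'x topology \<times> 's monoid \<times> ('x \<Rightarrow> 's \<Rightarrow> 'x)"

definition class_A :: "('x, 's) action_triple set" where
  "class_A = {(X, S, act). distal X S act}"

definition class_B :: "('x, 's) action_triple set" where
  "class_B = {(X, S, act). co_decomposable_to distal X S act}"

definition class_C :: "('x, 's) action_triple set" where
  "class_C = {(X, S, act). pseudo_co_decomposable_to distal X S act}"

definition class_D :: "('x, 's) action_triple set" where
  "class_D = {(X, S, act). transformation_semigroup X S act}"

end

theory Submission
  imports Defs "HOL-Computational_Algebra.Polynomial"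
begin

text \<open>
  A distal system is its own co-decomposition, and commuting elements give equal orbit sets, so the
  inclusions are immediate. For strictness of the first two, let \<open>A\<close> be a countably infinite
  abelian group of exponent 3, acting on its one-point compactification. Both the translations
  \<open>x \<mapsto> a + x\<close> and the generalized dihedral group of the maps \<open>x \<mapsto> a \<plusminus> x\<close> push all
  points to infinity, hence are not distal, whereas all their finite subgroups are. The translation
  group is the union of its commuting finite subgroups \<open>{0, a, -a}\<close>. The dihedral group is
  generated by these subgroups and the reflection \<open>x \<mapsto> - x\<close>, which permute with each other
  as sets. But as \<open>A\<close> has no 2-torsion, only the identity and \<open>x \<mapsto> a - x\<close> commute with
  \<open>x \<mapsto> a - x\<close>. So the member of a co-decomposition that contains a reflection absorbs all
  the others, hence is the whole group, which is not distal. For the last strictness, a monoid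
  consisting of the identity and a constant map has no distal sub-semigroup containing the constant map.
\<close>

section \<open>Actions and decompositions\<close>

text \<open>The head of \<open>xs\<close> is located in \<open>ys\<close> and pulled to the front
  past the entries before it; induction handles the rest. The invariant set \<open>Y\<close>
  confines commutation to meaningful states: points of the phase space for multi-transformation
  semigroups, its subsets for the pseudo version.\<close>

lemma foldl_cong_mset_if_commute:
  assumes "mset xs = mset ys" "u \<in> Y"
    and closed: "\<And>u a. u \<in> Y \<Longrightarrow> a \<in> set xs \<Longrightarrow> f u a \<in> Y"
    and comm: "\<And>u a b. u \<in> Y \<Longrightarrow> a \<in> set xs \<Longrightarrow> b \<in> set xs \<Longrightarrow> a \<noteq> b \<Longrightarrow>
                 f (f u a) b = f (f u b) a"
  shows "foldl f u xs = foldl f u ys"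
  using assms
proof (induction xs arbitrary: u ys)
  case Nil
  then show ?case by simp
next
  case (Cons a xs)
  have "a \<in> set ys" using Cons.prems(1) by (metis list.set_intros(1) set_mset_mset)
  then obtain ys1 ys2 where ys: "ys = ys1 @ a # ys2" by (meson split_list)
  note closed = Cons.prems(3) and comm = Cons.prems(4)
  \<comment> \<open>Applying \<open>a\<close> first or last makes no difference: it commutes with
    every entry other than itself.\<close>
  have front: "foldl f (f v a) zs = f (foldl f v zs) a"
    if "v \<in> Y" "set zs \<subseteq> set (a # xs)" for v zs
    using that
  proof (induction zs arbitrary: v)
    case (Cons z zs)
    then have "f (f v a) z = f (f v z) a"
      using Cons.prems comm[of v a z] by (cases "z = a") auto
    moreover have "f v z \<in> Y" using Cons.prems closed by auto
    ultimately show ?case using Cons.IH[of "f v z"] Cons.prems by simp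
  qed simp
  have eq: "mset xs = mset (ys1 @ ys2)" using Cons.prems(1) ys by simp
  then have "set (ys1 @ ys2) = set xs" by (metis set_mset_mset)
  then have sub: "set ys1 \<subseteq> set (a # xs)" by auto
  have "foldl f (f u a) xs = foldl f (f u a) (ys1 @ ys2)"
  proof (rule Cons.IH[OF eq])
    show "f u a \<in> Y" using Cons.prems(2) closed by simp
    show "f v b \<in> Y" if "v \<in> Y" "b \<in> set xs" for v b
      using that Cons.prems(3) by simp
    show "f (f v b) c = f (f v c) b"
      if "v \<in> Y" "b \<in> set xs" "c \<in> set xs" "b \<noteq> c" for v b c
      using that Cons.prems(4) by simp
  qed
  also have "\<dots> = foldl f (f (foldl f u ys1) a) ys2"
    using front[OF Cons.prems(2) sub] by simp
  finally show ?case using ys by simp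
qed

text \<open>With a discrete second factor, the preimage of an open set is a union of open slices
  times singletons.\<close>

lemma continuous_map_prod_discrete:
  assumes "\<And>s. s \<in> C \<Longrightarrow> continuous_map X Y (\<lambda>x. f x s)"
  shows "continuous_map (prod_topology X (discrete_topology C)) Y (\<lambda>(x, s). f x s)"
  unfolding continuous_map_def
proof (intro conjI allI impI)
  show "(\<lambda>(x, s). f x s) \<in> topspace (prod_topology X (discrete_topology C)) \<rightarrow> topspace Y"
    using assms by (auto simp: continuous_map_def Pi_iff)
  fix U assume U: "openin Y U"
  have "{p \<in> topspace (prod_topology X (discrete_topology C)). (case p of (x, s) \<Rightarrow> f x s) \<in> U}
        = (\<Union>s\<in>C. {x \<in> topspace X. f x s \<in> U} \<times> {s})"
    by auto
  moreover have "openin (prod_topology X (discrete_topology C))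
                   (\<Union>s\<in>C. {x \<in> topspace X. f x s \<in> U} \<times> {s})"
  proof (rule openin_Union, clarify)
    fix s assume "s \<in> C"
    then have "openin X {x \<in> topspace X. f x s \<in> U}"
      using assms U openin_continuous_map_preimage by fast
    then show "openin (prod_topology X (discrete_topology C)) ({x \<in> topspace X. f x s \<in> U} \<times> {s})"
      using \<open>s \<in> C\<close> by (simp add: openin_prod_Times_iff)
  qed
  ultimately show "openin (prod_topology X (discrete_topology C))
    {p \<in> topspace (prod_topology X (discrete_topology C)). (case p of (x, s) \<Rightarrow> f x s) \<in> U}"
    by simp
qed

section \<open>Proximal pairs and criteria for distality\<close>

lemma act_in_topspace:
  assumes "transformation_semigroup X S act" "x \<in> topspace X" "s \<in> carrier S"
  shows "act x s \<in> topspace X"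
proof -
  have "continuous_map (prod_topology X (discrete_topology (carrier S))) X (\<lambda>(x, s). act x s)"
    using assms(1) by (simp add: transformation_semigroup_def)
  from continuous_map_funspace[OF this] show ?thesis
    using assms(2,3) by (auto dest: funcset_mem[of _ _ _ "(x, s)"])
qed

lemma proximal_relationI:
  assumes "x \<in> topspace X" "y \<in> topspace X" "F \<noteq> bot" "F \<le> principal (carrier S)"
    "limitin X (act x) z F" "limitin X (act y) z F"
  shows "(x, y) \<in> proximal_relation X S act"
  unfolding proximal_relation_def mem_Collect_eq case_prod_conv
  using assms by (intro CollectI case_prodI2 SigmaI conjI exI[of _ F] exI[of _ z]) simp_all

lemma diagonal_in_proximal_relation:
  assumes "transformation_semigroup X S act" "x \<in> topspace X"
  shows "(x, x) \<in> proximal_relation X S act"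
proof -
  have S: "monoid S" and x: "act x \<one>\<^bsub>S\<^esub> = x"
    using assms by (auto simp: transformation_semigroup_def)
  show ?thesis
  proof (rule proximal_relationI)
    \<comment> \<open>This filter is the constant net at the identity.\<close>
    show "principal {\<one>\<^bsub>S\<^esub>} \<le> principal (carrier S)"
      using S by (simp add: monoid.one_closed)
    show "limitin X (act x) x (principal {\<one>\<^bsub>S\<^esub>})"
      using x assms(2) by (simp add: limitin_def eventually_principal)
    then show "limitin X (act x) x (principal {\<one>\<^bsub>S\<^esub>})" .
  qed (use assms(2) in \<open>simp_all add: principal_eq_bot_iff\<close>)
qed

text \<open>Orbits are finite, hence discrete in a Hausdorff space, so a convergent net of orbit
  points is eventually equal to its limit. A single \<open>s\<close> then sends both points of a
  proximal pair to \<open>z\<close>, and injectivity identifies them.\<close>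

lemma distal_if_finite_carrier:
  assumes ts: "transformation_semigroup X S act" and fin: "finite (carrier S)"
    and inj: "\<And>s. s \<in> carrier S \<Longrightarrow> inj_on (\<lambda>x. act x s) (topspace X)"
  shows "distal X S act"
proof -
  have eq: "x = y" if xy: "(x, y) \<in> proximal_relation X S act" for x y
  proof -
    obtain F z where x: "x \<in> topspace X" "y \<in> topspace X"
      and F: "F \<noteq> bot" "eventually (\<lambda>s. s \<in> carrier S) F"
      and lim: "limitin X (act x) z F" "limitin X (act y) z F"
      using xy unfolding proximal_relation_def by (auto simp: le_principal)
    have "eventually (\<lambda>s. act w s = z) F" if w: "w \<in> topspace X" "limitin X (act w) z F" for w
    proof -
      \<comment> \<open>A neighbourhood of \<open>z\<close> that excludes every other point of the
        orbit of \<open>w\<close>.\<close>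
      define V where "V = topspace X - (act w ` carrier S - {z})"
      have "closedin X (act w ` carrier S - {z})"
      proof (rule closedin_Hausdorff_finite)
        show "Hausdorff_space X" using ts by (simp add: transformation_semigroup_def)
        show "act w ` carrier S - {z} \<subseteq> topspace X"
          using act_in_topspace[OF ts w(1)] by blast
      qed (use fin in simp)
      then have "openin X V" unfolding V_def by (simp add: openin_diff)
      moreover have "z \<in> V" using w(2) by (simp add: limitin_def V_def)
      ultimately have "eventually (\<lambda>s. act w s \<in> V) F" using w(2) by (simp add: limitin_def)
      with F(2) show ?thesis by eventually_elim (auto simp: V_def)
    qed
    then have "eventually (\<lambda>s. s \<in> carrier S \<and> act x s = z \<and> act y s = z) F"
      using F(2) x lim by (simp add: eventually_conj_iff)
    from eventually_happens'[OF F(1) this]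
    obtain s where "s \<in> carrier S" "act x s = z" "act y s = z" by blast
    then show "x = y" using inj_onD[OF inj] x by metis
  qed
  have "proximal_relation X S act \<subseteq> topspace X \<times> topspace X"
    unfolding proximal_relation_def by blast
  then have "(x, y) \<in> proximal_relation X S act \<longleftrightarrow> x = y \<and> x \<in> topspace X" for x y
    using eq[of x y] diagonal_in_proximal_relation[OF ts, of x] by blast
  then have "proximal_relation X S act = {(x, x) | x. x \<in> topspace X}" by auto
  then show ?thesis using ts by (simp add: distal_def)
qed

text \<open>The constant net at \<open>s\<close> witnesses that \<open>x\<close> and
  \<open>y\<close> are proximal.\<close>

lemma not_distal_if_identifies:
  assumes "x \<in> topspace X" "y \<in> topspace X" "x \<noteq> y" "s \<in> carrier S"
    "act x s = act y s" "act x s \<in> topspace X"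
  shows "\<not> distal X S act"
proof -
  have "(x, y) \<in> proximal_relation X S act"
    using assms
    by (intro proximal_relationI[of _ _ _ "principal {s}" _ _ "act x s"])
       (simp_all add: limitin_def eventually_principal principal_eq_bot_iff)
  then show ?thesis using assms(3) by (auto simp: distal_def)
qed

section \<open>Reduction of arbitrary permutations to interchanges of two factors\<close>

lemma pseudo_multi_transformation_semigroupI:
  assumes "\<Gamma> \<noteq> {}" and ts: "\<And>\<alpha>. \<alpha> \<in> \<Gamma> \<Longrightarrow> transformation_semigroup X (S \<alpha>) (act \<alpha>)"
    and swap: "\<And>\<alpha> \<beta> x s t. \<alpha> \<in> \<Gamma> \<Longrightarrow> \<beta> \<in> \<Gamma> \<Longrightarrow> \<alpha> \<noteq> \<beta> \<Longrightarrow> x \<in> topspace X \<Longrightarrow>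
        s \<in> carrier (S \<alpha>) \<Longrightarrow> t \<in> carrier (S \<beta>) \<Longrightarrow>
        \<exists>t'\<in>carrier (S \<beta>). \<exists>s'\<in>carrier (S \<alpha>).
          act \<beta> (act \<alpha> x s) t = act \<alpha> (act \<beta> x t') s'"
  shows "pseudo_multi_transformation_semigroup X \<Gamma> S act"
proof -
  let ?f = "\<lambda>A \<alpha>. set_act (act \<alpha>) A (carrier (S \<alpha>))"
  \<comment> \<open>One inclusion is enough: exchanging \<alpha> and \<beta> gives the reverse
    one.\<close>
  have sub: "?f (?f A \<alpha>) \<beta> \<subseteq> ?f (?f A \<beta>) \<alpha>"
    if "\<alpha> \<in> \<Gamma>" "\<beta> \<in> \<Gamma>" "\<alpha> \<noteq> \<beta>" "A \<subseteq> topspace X" for A \<alpha> \<beta>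
  proof
    fix z assume "z \<in> ?f (?f A \<alpha>) \<beta>"
    then obtain x s t where x: "x \<in> A" "s \<in> carrier (S \<alpha>)" "t \<in> carrier (S \<beta>)"
      and z: "z = act \<beta> (act \<alpha> x s) t"
      unfolding set_act_def by blast
    with that obtain t' s' where "t' \<in> carrier (S \<beta>)" "s' \<in> carrier (S \<alpha>)"
      "z = act \<alpha> (act \<beta> x t') s'"
      using swap[of \<alpha> \<beta> x s t] by auto
    then show "z \<in> ?f (?f A \<beta>) \<alpha>" using x(1) unfolding set_act_def by blast
  qed
  have "foldl ?f {x} \<alpha>s = foldl ?f {x} (permute_list m \<alpha>s)"
    if "x \<in> topspace X" "set \<alpha>s \<subseteq> \<Gamma>" "m permutes {..<length \<alpha>s}" for x \<alpha>s m
  proof (rule foldl_cong_mset_if_commute[where Y = "Pow (topspace X)"])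
    show "mset \<alpha>s = mset (permute_list m \<alpha>s)" using that(3) by simp
    show "?f A \<alpha> \<in> Pow (topspace X)" if A: "A \<in> Pow (topspace X)" "\<alpha> \<in> set \<alpha>s" for A \<alpha>
      using A \<open>set \<alpha>s \<subseteq> \<Gamma>\<close> act_in_topspace[OF ts] by (fastforce simp: set_act_def)
    show "?f (?f A \<alpha>) \<beta> = ?f (?f A \<beta>) \<alpha>"
      if A: "A \<in> Pow (topspace X)" "\<alpha> \<in> set \<alpha>s" "\<beta> \<in> set \<alpha>s" "\<alpha> \<noteq> \<beta>" for A \<alpha> \<beta>
      using A \<open>set \<alpha>s \<subseteq> \<Gamma>\<close> sub[of \<alpha> \<beta> A] sub[of \<beta> \<alpha> A] by auto
  qed (use that in auto)
  then show ?thesis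
    using assms(1) ts unfolding pseudo_multi_transformation_semigroup_def by blast
qed

lemma multi_transformation_semigroupI:
  assumes "\<Gamma> \<noteq> {}" and ts: "\<And>\<alpha>. \<alpha> \<in> \<Gamma> \<Longrightarrow> transformation_semigroup X (S \<alpha>) (act \<alpha>)"
    and comm: "\<And>\<alpha> \<beta> x s t. \<alpha> \<in> \<Gamma> \<Longrightarrow> \<beta> \<in> \<Gamma> \<Longrightarrow> \<alpha> \<noteq> \<beta> \<Longrightarrow> x \<in> topspace X \<Longrightarrow>
        s \<in> carrier (S \<alpha>) \<Longrightarrow> t \<in> carrier (S \<beta>) \<Longrightarrow>
        act \<beta> (act \<alpha> x s) t = act \<alpha> (act \<beta> x t) s"
  shows "multi_transformation_semigroup X \<Gamma> S act"
proof -
  let ?f = "\<lambda>u (\<alpha>, s). act \<alpha> u s"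
  have "foldl ?f x ps = foldl ?f x (permute_list m ps)"
    if "x \<in> topspace X" and dist: "distinct (map fst ps)"
      and ps: "\<forall>(\<alpha>, s)\<in>set ps. \<alpha> \<in> \<Gamma> \<and> s \<in> carrier (S \<alpha>)"
      and m: "m permutes {..<length ps}" for x ps m
  proof (rule foldl_cong_mset_if_commute[where Y = "topspace X"])
    show "mset ps = mset (permute_list m ps)" using m by simp
    show "?f u p \<in> topspace X" if "u \<in> topspace X" "p \<in> set ps" for u p
      using that ps act_in_topspace[OF ts] by fastforce
    show "?f (?f u p) q = ?f (?f u q) p"
      if pq: "u \<in> topspace X" "p \<in> set ps" "q \<in> set ps" "p \<noteq> q" for u p q
    proof -
      \<comment> \<open>Indices do not repeat in \<open>ps\<close>, so different entries belong to
        different semigroups, and \<open>comm\<close> applies.\<close>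
      have "fst p \<noteq> fst q"
        using pq dist by (metis distinct_map inj_on_def)
      then show ?thesis using pq ps comm by (fastforce simp: case_prod_beta)
    qed
  qed (use that in auto)
  then show ?thesis
    using assms(1) ts unfolding multi_transformation_semigroup_def by blast
qed

text \<open>This is the defining condition for a list of length two and the transposition of its
  positions.\<close>

lemma multi_transformation_semigroup_commute:
  assumes "multi_transformation_semigroup X \<Gamma> S act" "\<alpha> \<in> \<Gamma>" "\<beta> \<in> \<Gamma>" "\<alpha> \<noteq> \<beta>"
    "x \<in> topspace X" "s \<in> carrier (S \<alpha>)" "t \<in> carrier (S \<beta>)"
  shows "act \<beta> (act \<alpha> x s) t = act \<alpha> (act \<beta> x t) s"
proof -
  let ?ps = "[(\<alpha>, s), (\<beta>, t)]" and ?m = "Transposition.transpose 0 (1::nat)"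
  have m: "?m permutes {..<length ?ps}" by (intro permutes_swap_id) auto
  have "foldl (\<lambda>u (\<alpha>, s). act \<alpha> u s) x ?ps =
        foldl (\<lambda>u (\<alpha>, s). act \<alpha> u s) x (permute_list ?m ?ps)"
    using assms m unfolding multi_transformation_semigroup_def
    by (elim conjE allE[of _ ?ps] ballE[of _ _ x] allE[of _ ?m]) auto
  then show ?thesis by (simp add: permute_list_def)
qed

lemma pseudo_if_multi_transformation_semigroup:
  assumes "multi_transformation_semigroup X \<Gamma> S act"
  shows "pseudo_multi_transformation_semigroup X \<Gamma> S act"
  using assms multi_transformation_semigroup_commute[OF assms]
  by (intro pseudo_multi_transformation_semigroupI)
     (auto simp: multi_transformation_semigroup_def)

section \<open>The inclusions between the four classes\<close>

lemma semigroup_generated_subset: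
  assumes "A \<subseteq> C" "\<And>a b. a \<in> C \<Longrightarrow> b \<in> C \<Longrightarrow> a \<otimes>\<^bsub>S\<^esub> b \<in> C"
  shows "semigroup_generated S A \<subseteq> C"
proof
  show "x \<in> C" if "x \<in> semigroup_generated S A" for x
    using that by induction (use assms in auto)
qed

lemma class_A_subset_B: "class_A \<subseteq> class_B"
proof clarify
  fix X S act assume "(X, S, act) \<in> (class_A :: ('x, 's) action_triple set)"
  then have d: "distal X S act" and ts: "transformation_semigroup X S act"
    by (auto simp: class_A_def distal_def)
  have S: "monoid S" using ts by (simp add: transformation_semigroup_def)
  \<comment> \<open>The only member is \<open>S\<close> itself, indexed by its carrier, so there are
    no two distinct indices to compare.\<close>
  have "multi_transformation_semigroup X {carrier S} (\<lambda>_. S) (\<lambda>_. act)"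
    using ts by (intro multi_transformation_semigroupI) auto
  moreover have "semigroup_generated S (carrier S) = carrier S"
    using S by (intro equalityI semigroup_generated_subset)
      (auto intro: semigroup_generated.base monoid.m_closed)
  ultimately have "co_decomposition X S act {carrier S} (\<lambda>_. S)"
    by (simp add: co_decomposition_def generating_subsemigroups_def)
  then have "\<exists>(\<Gamma> :: 's set set) M. co_decomposition X S act \<Gamma> M \<and>
      (\<forall>\<alpha>\<in>\<Gamma>. distal X (M \<alpha>) act)"
    using d by blast
  then show "(X, S, act) \<in> class_B"
    using ts by (simp add: class_B_def co_decomposable_to_def)
qed

lemma class_B_subset_C: "class_B \<subseteq> class_C"
  using pseudo_if_multi_transformation_semigroup
  unfolding class_B_def class_C_def co_decomposable_to_def pseudo_co_decomposable_to_def
    co_decomposition_def pseudo_co_decomposition_def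
  by blast

lemma class_C_subset_D: "class_C \<subseteq> class_D"
  by (auto simp: class_C_def class_D_def pseudo_co_decomposable_to_def)

section \<open>A transformation semigroup that is not pseudo-co-decomposable\<close>

lemma class_C_neq_D:
  fixes p q :: 'x and e c :: 's
  assumes "p \<noteq> q" "e \<noteq> c"
  shows "(class_C :: ('x, 's) action_triple set) \<noteq> class_D"
proof -
  define X where "X = discrete_topology {p, q}"
  \<comment> \<open>Here \<open>e\<close> is the identity and \<open>c\<close> is absorbing, in
    accordance with \<open>c\<close> acting as the constant map to \<open>p\<close>.\<close>
  define S :: "'s monoid" where
    "S = \<lparr>carrier = {e, c}, mult = \<lambda>s t. if s = e then t else c, one = e\<rparr>"
  define act :: "'x \<Rightarrow> 's \<Rightarrow> 'x" where "act x s = (if s = c then p else x)" for x s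
  have "monoid S" by (rule monoidI) (auto simp: S_def)
  moreover have "continuous_map (prod_topology X (discrete_topology (carrier S))) X
      (\<lambda>(x, s). act x s)"
    by (rule continuous_map_prod_discrete) (auto simp: X_def act_def)
  ultimately have "transformation_semigroup X S act"
    using assms
    by (auto simp: transformation_semigroup_def X_def S_def act_def compact_space_discrete_topology)
  then have "(X, S, act) \<in> class_D" by (simp add: class_D_def)
  moreover have "(X, S, act) \<notin> class_C"
  proof
    assume "(X, S, act) \<in> class_C"
    then obtain \<Gamma> :: "'s set set" and M where
      gen: "semigroup_generated S (\<Union>\<alpha>\<in>\<Gamma>. carrier (M \<alpha>)) = carrier S"
      and sub: "\<And>\<alpha>. \<alpha> \<in> \<Gamma> \<Longrightarrow> carrier (M \<alpha>) \<subseteq> carrier S"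
      and d: "\<And>\<alpha>. \<alpha> \<in> \<Gamma> \<Longrightarrow> distal X (M \<alpha>) act"
      unfolding class_C_def pseudo_co_decomposable_to_def pseudo_co_decomposition_def
        generating_subsemigroups_def by auto
    \<comment> \<open>Since \<open>c\<close> identifies \<open>p\<close> and \<open>q\<close>, no
      distal member contains it, and only \<open>e\<close> remains as a generator.\<close>
    have "c \<notin> carrier (M \<alpha>)" if "\<alpha> \<in> \<Gamma>" for \<alpha>
      using d[OF that] not_distal_if_identifies[of p X q c "M \<alpha>" act] assms(1)
      by (auto simp: X_def act_def)
    then have "(\<Union>\<alpha>\<in>\<Gamma>. carrier (M \<alpha>)) \<subseteq> {e}" using sub by (fastforce simp: S_def)
    then have "semigroup_generated S (\<Union>\<alpha>\<in>\<Gamma>. carrier (M \<alpha>)) \<subseteq> {e}"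
      by (rule semigroup_generated_subset) (auto simp: S_def)
    then show False using gen assms(2) by (auto simp: S_def)
  qed
  ultimately show ?thesis by blast
qed


section \<open>The generalized dihedral group on a one-point compactification\<close>

text \<open>The pair \<open>(a, e)\<close> stands for \<open>x \<mapsto> a - x\<close> if \<open>e\<close>, and for \<open>x \<mapsto> a + x\<close> otherwise.\<close>

fun dih_act :: "'a::ab_group_add \<Rightarrow> 'a \<times> bool \<Rightarrow> 'a" where
  "dih_act x (a, e) = (if e then a - x else a + x)"

text \<open>For a right action the left factor is applied first: the second map sends the shift
  \<open>a\<close> to \<open>b - a\<close> or \<open>b + a\<close>, and the signs multiply.\<close>

fun dih_mult :: "'a::ab_group_add \<times> bool \<Rightarrow> 'a \<times> bool \<Rightarrow> 'a \<times> bool" where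
  "dih_mult (a, e) (b, f) = (if f then b - a else b + a, e \<noteq> f)"

lemma dih_act_mult: "dih_act x (dih_mult g h) = dih_act (dih_act x g) h"
  by (cases g; cases h) (auto simp: algebra_simps)

lemma dih_mult_assoc: "dih_mult (dih_mult g h) k = dih_mult g (dih_mult h k)"
  by (cases g; cases h; cases k) (auto simp: algebra_simps)

lemma dih_mult_one [simp]: "dih_mult (0, False) g = g" "dih_mult g (0, False) = g"
  by (cases g; simp)+

lemma inj_dih_act: "inj (\<lambda>x. dih_act x g)"
  by (cases g) (auto simp: inj_on_def)

text \<open>The maps \<open>i\<close> and \<open>j\<close> transport points, with \<open>None\<close> at infinity, and group elements.\<close>

locale dihedral_action =
  fixes i :: "'a::ab_group_add option \<Rightarrow> 'x" and j :: "'a \<times> bool \<Rightarrow> 's"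
  assumes inj_i: "inj i" and inj_j: "inj j"
    and exponent_3: "\<And>a::'a. a + a + a = 0"
    and infinite_UNIV: "infinite (UNIV :: 'a set)"
begin

text \<open>A copy, inside the given type \<open>'x\<close>, of the one-point compactification of
  the discrete group.\<close>

definition X :: "'x topology" where
  "X = pullback_topology (range i) (inv_into UNIV i)
    (Alexandroff_compactification (discrete_topology UNIV))"

definition act :: "'x \<Rightarrow> 's \<Rightarrow> 'x" where
  "act x s = i (map_option (\<lambda>y. dih_act y (inv_into UNIV j s)) (inv_into UNIV i x))"

text \<open>Taking the carrier as argument makes \<open>M\<close> a family indexed by subsets of
  \<open>'s\<close>, as decompositions require; its members are then automatically pairwise
  distinct.\<close>

definition M :: "'s set \<Rightarrow> 's monoid" where
  "M C = \<lparr>carrier = C, mult = \<lambda>s t. j (dih_mult (inv_into UNIV j s) (inv_into UNIV j t)), one = j (0, False)\<rparr>"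

lemma inv_i [simp]: "inv_into UNIV i (i x) = x" and inv_j [simp]: "inv_into UNIV j (j g) = g"
  using inj_i inj_j by auto

lemma i_eq_iff [simp]: "i x = i y \<longleftrightarrow> x = y" and j_eq_iff [simp]: "j g = j h \<longleftrightarrow> g = h"
  using inj_i inj_j by (auto simp: inj_eq)

lemma act_simps [simp]:
  "act (i None) s = i None" "act (i (Some x)) (j g) = i (Some (dih_act x g))"
  by (simp_all add: act_def)

lemma M_simps [simp]: "carrier (M C) = C" "\<one>\<^bsub>M C\<^esub> = j (0, False)"
    "j g \<otimes>\<^bsub>M C\<^esub> j h = j (dih_mult g h)"
  by (simp_all add: M_def)

lemma mult_M: "s \<otimes>\<^bsub>M C\<^esub> t = s \<otimes>\<^bsub>M D\<^esub> t"
  by (simp add: M_def)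

text \<open>Compact subsets of a discrete space are the finite ones, so the open sets around
  infinity are the cofinite ones.\<close>

lemma openin_X: "openin X U \<longleftrightarrow> (\<exists>V. U = i ` V \<and> (None \<in> V \<longrightarrow> finite (- V)))"
proof -
  have *: "openin (Alexandroff_compactification (discrete_topology (UNIV :: 'a set))) V \<longleftrightarrow>
      (None \<in> V \<longrightarrow> finite (- V))" (is "?L \<longleftrightarrow> ?R") for V
  proof
    assume ?L
    then consider U where "V = Some ` U" | C where "finite C" "V = insert None (Some ` (UNIV - C))"
      by (auto simp: openin_Alexandroff_compactification compactin_discrete_topology)
    then show ?R
    proof cases
      case 2
      have "- V \<subseteq> Some ` C"
      proof
        show "x \<in> Some ` C" if "x \<in> - V" for x using that 2 by (cases x) auto
      qed
      then show ?thesis using 2 finite_subset by blast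
    qed auto
  next
    assume R: ?R
    show ?L
    proof (cases "None \<in> V")
      case True
      let ?C = "Some -` (- V)"
      have "finite ?C" using R True by (intro finite_vimageI) auto
      moreover have "V = insert None (Some ` (UNIV - ?C))"
      proof (rule Set.set_eqI)
        show "x \<in> V \<longleftrightarrow> x \<in> insert None (Some ` (UNIV - ?C))" for x
          using True by (cases x) auto
      qed
      ultimately show ?thesis
        unfolding openin_Alexandroff_compactification
        by (intro disjI2 exI[of _ ?C]) (simp add: compactin_discrete_topology)
    next
      case False
      have "V = Some ` (Some -` V)"
      proof (rule Set.set_eqI)
        show "x \<in> V \<longleftrightarrow> x \<in> Some ` (Some -` V)" for x using False by (cases x) auto
      qed
      then show ?thesis unfolding openin_Alexandroff_compactification
        by (metis openin_discrete_topology subset_UNIV)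
    qed
  qed
  have "inv_into UNIV i -` V \<inter> range i = i ` V" for V by auto
  then show ?thesis unfolding X_def openin_pullback_topology * by auto
qed

lemma topspace_X [simp]: "topspace X = range i"
  by (auto simp: X_def topspace_pullback_topology image_iff)

lemma continuous_map_i:
  "continuous_map (Alexandroff_compactification (discrete_topology UNIV)) X i"
  unfolding X_def by (rule continuous_map_pullback') (auto simp: comp_def)

lemma homeomorphic_map_i:
  "homeomorphic_map (Alexandroff_compactification (discrete_topology UNIV)) X i"
proof -
  have "continuous_map X (Alexandroff_compactification (discrete_topology UNIV)) (id \<circ> inv_into UNIV i)"
    unfolding X_def by (rule continuous_map_pullback) auto
  then have "homeomorphic_maps (Alexandroff_compactification (discrete_topology UNIV)) X i (inv_into UNIV i)"
    using continuous_map_i by (auto simp: homeomorphic_maps_def)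
  then show ?thesis using homeomorphic_map_maps by blast
qed

lemma compact_space_X: "compact_space X"
  using homeomorphic_compact_space[OF homeomorphic_map_imp_homeomorphic_space[OF homeomorphic_map_i]]
  by simp

lemma Hausdorff_space_X: "Hausdorff_space X"
  using homeomorphic_Hausdorff_space[OF homeomorphic_map_imp_homeomorphic_space[OF homeomorphic_map_i]]
  by (simp add: Hausdorff_space_Alexandroff_compactification locally_compact_space_discrete_topology)

lemma inj_act: "inj_on (\<lambda>x. act x s) (range i)"
proof -
  have "inj (map_option (\<lambda>y. dih_act y (inv_into UNIV j s)))"
    by (rule option.inj_map) (rule inj_dih_act)
  then show ?thesis by (auto simp: inj_on_def act_def)
qed

text \<open>The map fixes infinity and is injective, so preimages of cofinite sets are
  cofinite.\<close>

lemma continuous_map_act: "continuous_map X X (\<lambda>x. act x s)"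
  unfolding continuous_map_def
proof (intro conjI allI impI)
  show "(\<lambda>x. act x s) \<in> topspace X \<rightarrow> topspace X" by (auto simp: act_def)
  fix U assume "openin X U"
  then obtain V where V: "U = i ` V" "None \<in> V \<Longrightarrow> finite (- V)" unfolding openin_X by blast
  let ?f = "map_option (\<lambda>y. dih_act y (inv_into UNIV j s))"
  have "{x \<in> topspace X. act x s \<in> U} = i ` (?f -` V)"
    using V(1) by (auto simp: act_def)
  moreover have "finite (- (?f -` V))" if "None \<in> ?f -` V"
  proof -
    have "inj ?f" by (rule option.inj_map) (rule inj_dih_act)
    then show ?thesis using that V(2) finite_vimageI[of "- V" ?f] by (simp add: vimage_Compl)
  qed
  ultimately show "openin X {x \<in> topspace X. act x s \<in> U}" unfolding openin_X by blast
qed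

section \<open>Distality of finite submonoids and its failure for infinite ones\<close>

lemma transformation_semigroup_M:
  assumes "(0, False) \<in> K" and closed: "\<And>g h. g \<in> K \<Longrightarrow> h \<in> K \<Longrightarrow> dih_mult g h \<in> K"
  shows "transformation_semigroup X (M (j ` K)) act"
proof -
  have "monoid (M (j ` K))"
    using assms by (intro monoidI) (auto simp: dih_mult_assoc)
  moreover have "act x (j (0, False)) = x" if "x \<in> range i" for x
    using that by (auto simp: act_def option.map_id[unfolded id_def])
  moreover have "act x (j g \<otimes>\<^bsub>M C\<^esub> j h) = act (act x (j g)) (j h)" for x g h C
    by (simp add: act_def dih_act_mult option.map_comp comp_def)
  ultimately show ?thesis
    using continuous_map_prod_discrete[OF continuous_map_act] compact_space_X Hausdorff_space_X
    by (auto simp: transformation_semigroup_def)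
qed

lemma distal_M:
  assumes "finite K" "(0, False) \<in> K" "\<And>g h. g \<in> K \<Longrightarrow> h \<in> K \<Longrightarrow> dih_mult g h \<in> K"
  shows "distal X (M (j ` K)) act"
proof (rule distal_if_finite_carrier)
  show "transformation_semigroup X (M (j ` K)) act"
    using assms(2,3) by (rule transformation_semigroup_M)
  show "finite (carrier (M (j ` K)))" using assms(1) by simp
  show "inj_on (\<lambda>x. act x s) (topspace X)" for s unfolding topspace_X by (rule inj_act)
qed

text \<open>Along the cofinite filter on \<open>K\<close>, every point tends to the point at infinity.\<close>

lemma not_distal_if_infinite:
  assumes carrier: "carrier S = j ` K" and K: "infinite K"
  shows "\<not> distal X S act"
proof -
  define F where "F = inf cofinite (principal (carrier S))"
  have inf: "infinite (carrier S)"
    using K finite_imageD[OF _ inj_on_subset[OF inj_j subset_UNIV]] unfolding carrier by blast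
  have "F \<noteq> bot"
    using inf unfolding F_def trivial_limit_def eventually_inf_principal eventually_cofinite by simp
  moreover have "F \<le> principal (carrier S)" by (simp add: F_def)
  moreover have "limitin X (act (i None)) (i None) F"
    by (simp add: limitin_def)
  moreover have "limitin X (act (i (Some 0))) (i None) F"
    unfolding limitin_def
  proof (intro conjI allI impI)
    fix U assume "openin X U \<and> i None \<in> U"
    then obtain V where V: "U = i ` V" "finite (- V)" by (auto simp: openin_X)
    \<comment> \<open>The element \<open>(a, e)\<close> sends 0 to \<open>a\<close> for either value
      of \<open>e\<close>, so each of the finitely many points outside \<open>V\<close> accounts for
      at most two exceptions.\<close>
    have "{s. \<not> (s \<in> carrier S \<longrightarrow> act (i (Some 0)) s \<in> U)} \<subseteq> j ` ((Some -` (- V)) \<times> UNIV)"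
      using V(1) by (auto simp: carrier image_iff split: if_splits)
    moreover have "finite (j ` ((Some -` (- V)) \<times> UNIV))"
      using V(2) by (intro finite_imageI finite_cartesian_product finite_vimageI) auto
    ultimately show "eventually (\<lambda>s. act (i (Some 0)) s \<in> U) F"
      unfolding F_def eventually_inf_principal eventually_cofinite by (rule finite_subset)
  qed simp
  ultimately have "(i None, i (Some 0)) \<in> proximal_relation X S act"
    by (intro proximal_relationI) simp_all
  then show ?thesis by (auto simp: distal_def)
qed

section \<open>Finite subgroups and the translation group\<close>

definition shifts :: "'a set \<Rightarrow> ('a \<times> bool) set" where
  "shifts A = A \<times> {False}"

definition cyclic :: "'a \<Rightarrow> ('a \<times> bool) set" where
  "cyclic a = shifts {0, a, - a}"

definition reflection :: "('a \<times> bool) set" where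
  "reflection = {(0, False), (0, True)}"

text \<open>This form of exponent 3 both closes \<open>{0, a, - a}\<close> under addition and rules
  out 2-torsion.\<close>

lemma add_self: "(a::'a) + a = - a"
  using exponent_3[of a] by (simp only: eq_neg_iff_add_eq_0)

lemma cyclic_closed: "g \<in> cyclic a \<Longrightarrow> h \<in> cyclic a \<Longrightarrow> dih_mult g h \<in> cyclic a"
  using add_self[of a] add_self[of "- a"] by (auto simp: cyclic_def shifts_def)

lemma reflection_closed: "g \<in> reflection \<Longrightarrow> h \<in> reflection \<Longrightarrow> dih_mult g h \<in> reflection"
  by (auto simp: reflection_def)

lemma distal_cyclic: "distal X (M (j ` cyclic a)) act"
  by (rule distal_M) (auto intro: cyclic_closed, auto simp: cyclic_def shifts_def)

lemma distal_reflection: "distal X (M (j ` reflection)) act"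
  by (rule distal_M) (auto intro: reflection_closed, auto simp: reflection_def)

lemma shift_in_cyclic: "(a, False) \<in> cyclic a"
  by (simp add: cyclic_def shifts_def)

lemma class_A_neq_B: "(class_A :: ('x, 's) action_triple set) \<noteq> class_B"
proof -
  \<comment> \<open>As \<open>a\<close> and \<open>- a\<close> yield the same subgroup, the indices
    are the subgroups rather than the group elements.\<close>
  let ?S = "M (j ` shifts UNIV)" and ?\<Gamma> = "range (\<lambda>a. j ` cyclic a)"
  have ts: "transformation_semigroup X ?S act"
    by (rule transformation_semigroup_M) (auto simp: shifts_def)
  have "multi_transformation_semigroup X ?\<Gamma> M (\<lambda>_. act)"
  proof (rule multi_transformation_semigroupI)
    show "transformation_semigroup X (M \<alpha>) act" if "\<alpha> \<in> ?\<Gamma>" for \<alpha>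
      using that distal_cyclic by (auto simp: distal_def)
    show "act (act x s) t = act (act x t) s"
      if "\<alpha> \<in> ?\<Gamma>" "\<beta> \<in> ?\<Gamma>" "s \<in> carrier (M \<alpha>)" "t \<in> carrier (M \<beta>)" for \<alpha> \<beta> x s t
      using that
      by (auto simp: act_def cyclic_def shifts_def option.map_comp comp_def algebra_simps)
  qed auto
  moreover have "semigroup_generated ?S (\<Union>\<alpha>\<in>?\<Gamma>. carrier (M \<alpha>)) = carrier ?S"
  proof
    show "semigroup_generated ?S (\<Union>\<alpha>\<in>?\<Gamma>. carrier (M \<alpha>)) \<subseteq> carrier ?S"
      by (rule semigroup_generated_subset) (auto simp: cyclic_def shifts_def)
    show "carrier ?S \<subseteq> semigroup_generated ?S (\<Union>\<alpha>\<in>?\<Gamma>. carrier (M \<alpha>))"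
      using shift_in_cyclic
      by (force simp: shifts_def intro: semigroup_generated.base)
  qed
  ultimately have "co_decomposition X ?S act ?\<Gamma> M"
    unfolding co_decomposition_def generating_subsemigroups_def
    by (auto simp: cyclic_def shifts_def)
  then have "co_decomposable_to distal X ?S act"
    unfolding co_decomposable_to_def using ts distal_cyclic by (intro conjI exI) auto
  moreover have "\<not> distal X ?S act"
    using infinite_UNIV
    by (intro not_distal_if_infinite[of _ "shifts UNIV"])
       (auto simp: shifts_def finite_cartesian_product_iff)
  ultimately have "(X, ?S, act) \<in> class_B" "(X, ?S, act) \<notin> class_A"
    by (simp_all add: class_A_def class_B_def)
  then show ?thesis by blast
qed

section \<open>The dihedral group: pseudo-co-decomposable but not co-decomposable\<close>

lemma cyclic_commute: "g \<in> cyclic a \<Longrightarrow> h \<in> cyclic b \<Longrightarrow> dih_mult g h = dih_mult h g"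
  by (auto simp: cyclic_def shifts_def add.commute)

text \<open>Conjugation by \<open>x \<mapsto> - x\<close> inverts translations and so preserves each
  \<open>cyclic a\<close>. As it is an involution, one \<open>h'\<close> serves both orders of
  multiplication.\<close>

lemma reflection_normalizes_cyclic:
  assumes "g \<in> reflection" "h \<in> cyclic a"
  obtains h' where "h' \<in> cyclic a" "dih_mult g h = dih_mult h' g" "dih_mult h g = dih_mult g h'"
proof
  let ?h = "if snd g then (- fst h, False) else h"
  show "?h \<in> cyclic a" using assms(2) by (auto simp: cyclic_def shifts_def)
  show "dih_mult g h = dih_mult ?h g" "dih_mult h g = dih_mult g ?h"
    using assms by (auto simp: reflection_def cyclic_def shifts_def)
qed

lemma pseudo_co_decomposable_dihedral: "pseudo_co_decomposable_to distal X (M (range j)) act"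
proof -
  let ?S = "M (range j)" and ?\<Gamma> = "insert (j ` reflection) (range (\<lambda>a. j ` cyclic a))"
  have d: "distal X (M \<alpha>) act" if "\<alpha> \<in> ?\<Gamma>" for \<alpha>
    using that distal_cyclic distal_reflection by auto
  \<comment> \<open>Members permute as sets: two translation subgroups commute elementwise, and a
    translation subgroup is normalized by the reflection.\<close>
  have swap: "\<exists>h'\<in>H. \<exists>g'\<in>G. dih_mult g h = dih_mult h' g'"
    if GH: "G = reflection \<or> G \<in> range cyclic" "H = reflection \<or> H \<in> range cyclic"
      "G \<noteq> H" "g \<in> G" "h \<in> H" for G H g h
  proof -
    consider a b where "G = cyclic a" "H = cyclic b" | b where "G = reflection" "H = cyclic b"
      | b where "G = cyclic b" "H = reflection"
      using GH(1-3) by blast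
    then show ?thesis
    proof cases
      case 1
      then show ?thesis using GH(4,5) cyclic_commute by blast
    next
      case 2
      then show ?thesis using GH(4,5) reflection_normalizes_cyclic by metis
    next
      case 3
      then show ?thesis using GH(4,5) reflection_normalizes_cyclic by metis
    qed
  qed
  have "pseudo_multi_transformation_semigroup X ?\<Gamma> M (\<lambda>_. act)"
  proof (rule pseudo_multi_transformation_semigroupI)
    show "transformation_semigroup X (M \<alpha>) act" if "\<alpha> \<in> ?\<Gamma>" for \<alpha>
      using d[OF that] by (simp add: distal_def)
    show "\<exists>t'\<in>carrier (M \<beta>). \<exists>s'\<in>carrier (M \<alpha>). act (act x s) t = act (act x t') s'"
      if a: "\<alpha> \<in> ?\<Gamma>" "\<beta> \<in> ?\<Gamma>" "\<alpha> \<noteq> \<beta>" "s \<in> carrier (M \<alpha>)" "t \<in> carrier (M \<beta>)"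
      for \<alpha> \<beta> x s t
    proof -
      obtain G H where G: "\<alpha> = j ` G" "G = reflection \<or> G \<in> range cyclic"
        and H: "\<beta> = j ` H" "H = reflection \<or> H \<in> range cyclic"
        using a(1,2) by auto
      obtain g h where gh: "s = j g" "g \<in> G" "t = j h" "h \<in> H"
        using a(4,5) G(1) H(1) by auto
      obtain h' g' where "h' \<in> H" "g' \<in> G" and eq: "dih_mult g h = dih_mult h' g'"
        using swap[OF G(2) H(2) _ gh(2,4)] a(3) G(1) H(1) by blast
      moreover have "act (act x (j g)) (j h) = act (act x (j h')) (j g')"
        using eq by (simp add: act_def option.map_comp comp_def flip: dih_act_mult)
      ultimately show ?thesis using G(1) H(1) gh by auto
    qed
  qed auto
  moreover have "inj_on (\<lambda>\<alpha>. carrier (M \<alpha>)) ?\<Gamma>" by (simp add: inj_on_def)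
  moreover have "carrier ?S \<subseteq> semigroup_generated ?S (\<Union>\<alpha>\<in>?\<Gamma>. carrier (M \<alpha>))"
  proof
    fix s assume "s \<in> carrier ?S"
    then obtain a e where s: "s = j (a, e)" by auto
    have "j (0, e) \<in> j ` reflection" by (cases e) (auto simp: reflection_def)
    then have refl: "j (0, e) \<in> (\<Union>\<alpha>\<in>?\<Gamma>. carrier (M \<alpha>))" by simp
    have "j (a, False) \<in> j ` cyclic a" using shift_in_cyclic by blast
    then have shift: "j (a, False) \<in> (\<Union>\<alpha>\<in>?\<Gamma>. carrier (M \<alpha>))"
      by (simp only: M_simps) blast
    \<comment> \<open>First the sign, then the translation: each element is a product of one from
      \<open>reflection\<close> and one from \<open>cyclic a\<close>.\<close>
    have eq: "s = j (0, e) \<otimes>\<^bsub>?S\<^esub> j (a, False)" using s by simp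
    show "s \<in> semigroup_generated ?S (\<Union>\<alpha>\<in>?\<Gamma>. carrier (M \<alpha>))"
      unfolding eq
      by (rule semigroup_generated.mult[OF semigroup_generated.base[OF refl]
            semigroup_generated.base[OF shift]])
  qed
  moreover have "semigroup_generated ?S (\<Union>\<alpha>\<in>?\<Gamma>. carrier (M \<alpha>)) \<subseteq> carrier ?S"
    by (rule semigroup_generated_subset) auto
  ultimately have "pseudo_co_decomposition X ?S act ?\<Gamma> M"
    unfolding pseudo_co_decomposition_def generating_subsemigroups_def
    by (auto intro: mult_M)
  then show ?thesis
    unfolding pseudo_co_decomposable_to_def
    using d transformation_semigroup_M[of UNIV] by (intro conjI exI) auto
qed

text \<open>Evaluation at 0 gives \<open>(a - b) + (a - b) = 0\<close> if \<open>g\<close> is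
  \<open>x \<mapsto> b - x\<close>, and \<open>b + b = 0\<close> if it is
  \<open>x \<mapsto> b + x\<close>. Without 2-torsion these force \<open>b = a\<close> and
  \<open>b = 0\<close> respectively.\<close>

lemma commutes_with_reflection:
  fixes a :: 'a
  assumes "\<And>x. dih_act (dih_act x g) (a, True) = dih_act (dih_act x (a, True)) g"
  shows "g = (0, False) \<or> g = (a, True)"
proof (cases g)
  case (Pair b f)
  have no_2_torsion: "c = 0" if "c + c = 0" for c :: 'a
    using that add_self[of c] by (metis neg_equal_0_iff_equal)
  show ?thesis
  proof (cases f)
    case True
    then have eq: "a - b = b - a" using assms[of 0] Pair by simp
    have "(a - b) + (a - b) = (a - b) - (b - a)" by simp
    also have "\<dots> = 0" unfolding eq by simp
    finally have "a - b = 0" by (rule no_2_torsion)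
    then show ?thesis using True Pair by simp
  next
    case False
    then have eq: "a - b = b + a" using assms[of 0] Pair by simp
    have "b + b = (b + a) - (a - b)" by simp
    also have "\<dots> = 0" unfolding eq by simp
    finally have "b = 0" by (rule no_2_torsion)
    then show ?thesis using False Pair by simp
  qed
qed

lemma not_co_decomposable_dihedral: "\<not> co_decomposable_to distal X (M (range j)) act"
proof
  let ?S = "M (range j)"
  assume "co_decomposable_to distal X ?S act"
  then obtain \<Gamma> :: "'s set set" and N
    where cd: "co_decomposition X ?S act \<Gamma> N"
      and d: "\<And>\<alpha>. \<alpha> \<in> \<Gamma> \<Longrightarrow> distal X (N \<alpha>) act"
    unfolding co_decomposable_to_def by blast
  have multi: "multi_transformation_semigroup X \<Gamma> N (\<lambda>_. act)"
    using cd by (simp add: co_decomposition_def)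
  have gens: "generating_subsemigroups ?S \<Gamma> N"
    using cd by (simp add: co_decomposition_def)
  have sub: "carrier (N \<alpha>) \<subseteq> range j" if "\<alpha> \<in> \<Gamma>" for \<alpha>
    using gens that by (simp add: generating_subsemigroups_def)
  have mult: "s \<otimes>\<^bsub>N \<alpha>\<^esub> t = s \<otimes>\<^bsub>?S\<^esub> t"
    if "\<alpha> \<in> \<Gamma>" "s \<in> carrier (N \<alpha>)" "t \<in> carrier (N \<alpha>)" for \<alpha> s t
    using gens that unfolding generating_subsemigroups_def by blast
  have gen: "semigroup_generated ?S (\<Union>\<alpha>\<in>\<Gamma>. carrier (N \<alpha>)) = range j"
    using gens by (simp add: generating_subsemigroups_def)
  \<comment> \<open>Otherwise all generators are translations, which are closed under products and
    produce no reflection.\<close>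
  have "\<exists>\<alpha>\<in>\<Gamma>. \<exists>a. j (a, True) \<in> carrier (N \<alpha>)"
  proof (rule ccontr)
    assume no: "\<not> ?thesis"
    have "(\<Union>\<alpha>\<in>\<Gamma>. carrier (N \<alpha>)) \<subseteq> j ` shifts UNIV"
    proof clarify
      fix \<alpha> s assume s: "\<alpha> \<in> \<Gamma>" "s \<in> carrier (N \<alpha>)"
      then have "s \<in> range j" using sub by blast
      then obtain a e where "s = j (a, e)" by auto
      with no s show "s \<in> j ` shifts UNIV" by (cases e) (auto simp: shifts_def)
    qed
    then have "semigroup_generated ?S (\<Union>\<alpha>\<in>\<Gamma>. carrier (N \<alpha>)) \<subseteq> j ` shifts UNIV"
      by (rule semigroup_generated_subset) (auto simp: shifts_def)
    then have "j (0, True) \<in> j ` shifts UNIV" using gen by blast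
    then show False by (auto simp: shifts_def)
  qed
  then obtain \<alpha> a where \<alpha>: "\<alpha> \<in> \<Gamma>" "j (a, True) \<in> carrier (N \<alpha>)" by blast
  have "monoid (N \<alpha>)"
    using d[OF \<alpha>(1)] by (simp add: distal_def transformation_semigroup_def)
  then have closed: "s \<otimes>\<^bsub>?S\<^esub> t \<in> carrier (N \<alpha>)"
    if "s \<in> carrier (N \<alpha>)" "t \<in> carrier (N \<alpha>)" for s t
    using monoid.m_closed[OF _ that] mult[OF \<alpha>(1) that] by simp
  \<comment> \<open>The identity of \<open>N \<alpha>\<close> is not assumed to be that of the
    group; the group identity is obtained as the square of the reflection.\<close>
  have one_in: "j (0, False) \<in> carrier (N \<alpha>)"
    using closed[OF \<alpha>(2) \<alpha>(2)] by simp
  have "carrier (N \<beta>) \<subseteq> carrier (N \<alpha>)" if \<beta>: "\<beta> \<in> \<Gamma>" for \<beta>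
  proof (cases "\<beta> = \<alpha>")
    case False
    show ?thesis
    proof
      fix s assume s: "s \<in> carrier (N \<beta>)"
      then have "s \<in> range j" using sub[OF \<beta>] by blast
      then obtain h where h: "s = j h" by blast
      have "dih_act (dih_act x h) (a, True) = dih_act (dih_act x (a, True)) h" for x
        using multi_transformation_semigroup_commute[OF multi \<beta> \<alpha>(1) False _ s \<alpha>(2),
            of "i (Some x)"] h by simp
      then have "h = (0, False) \<or> h = (a, True)" by (rule commutes_with_reflection)
      then show "s \<in> carrier (N \<alpha>)" using h one_in \<alpha>(2) by auto
    qed
  qed auto
  \<comment> \<open>The member holding the reflection contains all generators and is closed, so it
    is the whole infinite group.\<close>
  then have "semigroup_generated ?S (\<Union>\<alpha>\<in>\<Gamma>. carrier (N \<alpha>)) \<subseteq> carrier (N \<alpha>)"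
    by (intro semigroup_generated_subset UN_least closed)
  then have "carrier (N \<alpha>) = j ` UNIV" using gen sub[OF \<alpha>(1)] by blast
  then have "\<not> distal X (N \<alpha>) act"
    by (rule not_distal_if_infinite) (simp add: finite_prod infinite_UNIV)
  then show False using d[OF \<alpha>(1)] by contradiction
qed

lemma class_B_neq_C: "(class_B :: ('x, 's) action_triple set) \<noteq> class_C"
proof -
  have "(X, M (range j), act) \<in> class_C" "(X, M (range j), act) \<notin> class_B"
    using pseudo_co_decomposable_dihedral not_co_decomposable_dihedral
    by (simp_all add: class_B_def class_C_def)
  then show ?thesis by blast
qed

end

section \<open>A countably infinite group of exponent 3 inside arbitrary infinite types\<close>

lemma dihedral_action_exists:
  assumes "infinite (UNIV :: 'x set)" "infinite (UNIV :: 's set)"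
  obtains i :: "3 poly option \<Rightarrow> 'x" and j :: "3 poly \<times> bool \<Rightarrow> 's"
  where "dihedral_action i j"
proof -
  obtain f :: "nat \<Rightarrow> 'x" and g :: "nat \<Rightarrow> 's" where fg: "inj f" "inj g"
    using assms infinite_countable_subset by meson
  \<comment> \<open>The group is that of polynomials over the integers modulo 3. Coding coefficient
    lists by naturals embeds it, with infinity or a sign adjoined, into any infinite type.\<close>
  define n :: "3 poly \<Rightarrow> nat" where "n = to_nat \<circ> coeffs"
  have n: "inj n" by (auto simp: n_def inj_on_def coeffs_eq_iff)
  define i where "i = f \<circ> to_nat \<circ> map_option n"
  define j where "j = g \<circ> to_nat \<circ> map_prod n (id :: bool \<Rightarrow> bool)"
  have "inj i" unfolding i_def using fg n by (intro inj_compose option.inj_map) auto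
  moreover have "inj j" unfolding j_def using fg n by (intro inj_compose prod.inj_map) auto
  moreover have "a + a + a = 0" for a :: "3 poly"
  proof -
    have "a + a + a = of_int 3 * a" by (simp add: algebra_simps)
    also have "(of_int 3 :: 3 poly) = [:of_int 3:]" by (simp add: of_int_poly)
    also have "(of_int 3 :: 3) = 0" by simp
    finally show ?thesis by simp
  qed
  moreover have "infinite (UNIV :: 3 poly set)"
  proof -
    have "inj (\<lambda>n. monom (1::3) n)" by (auto simp: inj_on_def monom_eq_iff')
    then show ?thesis using finite_subset[OF subset_UNIV] range_inj_infinite by blast
  qed
  ultimately show thesis using that by (simp add: dihedral_action_def)
qed

theorem corollary3p9:
  shows "((class_A :: ('x, 's) action_triple set) \<subseteq> class_B \<and>
          (class_B :: ('x, 's) action_triple set) \<subseteq> class_C \<and>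
          (class_C :: ('x, 's) action_triple set) \<subseteq> class_D) \<and>
         (infinite (UNIV :: 'x set) \<and> infinite (UNIV :: 's set) \<longrightarrow>
          (class_A :: ('x, 's) action_triple set) \<subset> class_B \<and>
          (class_B :: ('x, 's) action_triple set) \<subset> class_C \<and>
          (class_C :: ('x, 's) action_triple set) \<subset> class_D)"
proof (intro conjI impI psubsetI)
  assume inf: "infinite (UNIV :: 'x set) \<and> infinite (UNIV :: 's set)"
  obtain i :: "3 poly option \<Rightarrow> 'x" and j :: "3 poly \<times> bool \<Rightarrow> 's"
    where ij: "dihedral_action i j"
    by (rule dihedral_action_exists[OF conjunct1[OF inf] conjunct2[OF inf]])
  show "(class_A :: ('x, 's) action_triple set) \<noteq> class_B"
    using ij by (rule dihedral_action.class_A_neq_B)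
  show "(class_B :: ('x, 's) action_triple set) \<noteq> class_C"
    using ij by (rule dihedral_action.class_B_neq_C)
  \<comment> \<open>These supply the two points and the two semigroup elements for the constant-map
    example.\<close>
  have "i None \<noteq> i (Some 0)" "j (0, False) \<noteq> j (0, True)"
    using ij by (auto simp: dihedral_action_def inj_eq)
  then show "(class_C :: ('x, 's) action_triple set) \<noteq> class_D"
    by (rule class_C_neq_D)
qed (rule class_A_subset_B class_B_subset_C class_C_subset_D)+

end
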